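(* Let $x\in S_{n-1}$ with $F_x=\langle a^t\rangle$. Then there exist an integer $j$ coprime to $\frac nt$ (hence invertible modulo $\frac nt$, with inverse denoted $j^{-1}$), a permutation $\sigma_x\in S_{t-1}$, and integers $1\le u_i\le\frac nt$ for $1\le i\le t-1$ such that, modulo $n$, $$x(i)=u_it+\sigma_x(i)\quad(1\le i\le t-1),\qquad x(qt)=qjt\quad(1\le q\le\tfrac nt),\qquad x(qt+i)=qx(t)+x(i).$$ Furthermore, modulo $n$, $$x^{-1}(i)=-j^{-1}u_{\sigma_x^{-1}(i)}\,t+\sigma_x^{-1}(i)\quad(1\le i\le t-1),\qquad x^{-1}(t)=j^{-1}t,\qquad x^{-1}(qt+i)=qx^{-1}(t)+x^{-1}(i).$$ In the last relation of each line, $1\le q\le\frac nt$ and $1\le i\le t-1$.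
   Context: $n\ge2$. Identify $\{1,\dots,n\}$ with $\mathbb{Z}/n\mathbb{Z}$ (so $n=0$) and $S_n$ with the bijections of $\mathbb{Z}/n\mathbb{Z}$ under composition (right-to-left). $S_{n-1}$ is the subgroup of those $x$ with $x(n)=n$; $a=(1\,2\,\cdots\,n)$ is the shift $i\mapsto i+1$; $C_n=\langle a\rangle$. The group $C_n$ acts on the right on the set $S_{n-1}$ by $x\lhd a^r=a^{-x(r)}xa^r$, and $F_x$ is the stabilizer of $x$ under this action. Whenever we write $F_x=\langle a^t\rangle$, $t$ is the positive divisor of $n$ with this property. $S_{t-1}$ is the group of permutations of $\{1,\dots,t-1\}$ (trivial for $t=1$). *)

theory Defs
  imports "HOL-Algebra.Algebra" "HOL-Number_Theory.Modular_Inverse"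
begin

text \<open>The elements of \<open>\<int>/n\<int>\<close> are represented by \<open>{1..n}\<close>, with \<open>n\<close> standing for \<open>0\<close>;
  \<open>rep n k\<close> is the class of \<open>k\<close>.\<close>

definition rep :: "nat \<Rightarrow> int \<Rightarrow> nat" where
  "rep n k = nat ((k - 1) mod int n) + 1"

definition shift :: "nat \<Rightarrow> nat \<Rightarrow> nat" where
  "shift n = cycle_of_list [1..<Suc n]"

abbreviation cyc_group :: "nat \<Rightarrow> (nat \<Rightarrow> nat) monoid" where
  "cyc_group n \<equiv> subgroup_generated (sym_group n) {shift n}"

text \<open>The right action \<open>x \<lhd> a\<^sup>r = a\<^bsup>-x(r)\<^esup> x a\<^sup>r\<close>, as a function of the group element \<open>a\<^sup>r\<close>.
  Lemma \<open>ract_shift_pow\<close> below shows that the description determines the value.\<close>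

definition ract :: "nat \<Rightarrow> (nat \<Rightarrow> nat) \<Rightarrow> (nat \<Rightarrow> nat) \<Rightarrow> (nat \<Rightarrow> nat)" where
  "ract n x g = (THE y. \<exists>r::int. g = shift n [^]\<^bsub>sym_group n\<^esub> r \<and>
     y = shift n [^]\<^bsub>sym_group n\<^esub> (- int (x (rep n r)))
           \<otimes>\<^bsub>sym_group n\<^esub> x \<otimes>\<^bsub>sym_group n\<^esub> shift n [^]\<^bsub>sym_group n\<^esub> r)"

definition Fstab :: "nat \<Rightarrow> (nat \<Rightarrow> nat) \<Rightarrow> (nat \<Rightarrow> nat) set" where
  "Fstab n x = stabilizer (cyc_group n) (\<lambda>g y. ract n y g) x"

lemma rep_in: "n > 0 \<Longrightarrow> rep n k \<in> {1..n}"
  using pos_mod_bound[of "int n" "k - 1"] pos_mod_sign[of "int n" "k - 1"]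
  unfolding rep_def by (simp add: nat_less_iff Suc_le_eq)

lemma rep_cong: "n > 0 \<Longrightarrow> [int (rep n k) = k] (mod int n)"
  unfolding rep_def cong_def by (simp add: mod_simps)

lemma rep_eqI:
  assumes "n > 0" "i \<in> {1..n}" "[int i = k] (mod int n)"
  shows "rep n k = i"
proof -
  have "(k - 1) mod int n = (int i - 1) mod int n"
    using assms(3) by (metis cong_def mod_diff_left_eq)
  also have "\<dots> = int i - 1"
    using assms(2) by (intro mod_pos_pos_trivial) auto
  finally show ?thesis
    using assms(2) unfolding rep_def by auto
qed

lemma rep_congI: "[k = l] (mod int n) \<Longrightarrow> rep n k = rep n l"
  unfolding rep_def cong_def by (metis mod_diff_left_eq)

lemma shift_apply:
  assumes "n > 0" "i \<in> {1..n}"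
  shows "shift n i = rep n (int i + 1)"
proof -
  have "map (shift n) [1..<Suc n] = rotate 1 [1..<Suc n]"
    using cyclic_rotation[of "[1..<Suc n]" 1] by (simp add: shift_def del: upt_Suc)
  hence "map (shift n) [1..<Suc n] ! (i - 1) = rotate 1 [1..<Suc n] ! (i - 1)"
    by (rule arg_cong)
  hence "shift n i = [1..<Suc n] ! (i mod n)"
    using assms by (auto simp: nth_rotate simp del: upt_Suc rotate_Suc)
  also have "\<dots> = 1 + i mod n"
    using assms by (subst nth_upt) auto
  also have "\<dots> = rep n (int i + 1)"
    by (simp add: rep_def flip: zmod_int)
  finally show ?thesis .
qed

lemma shift_closed: "shift n \<in> carrier (sym_group n)"
  using cycle_permutes[of "[1..<Suc n]"]
  by (simp add: shift_def sym_group_carrier atLeastLessThanSuc_atLeastAtMost del: upt_Suc)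

lemma shift_nat_pow_apply:
  assumes "n > 0" "i \<in> {1..n}"
  shows "(shift n [^]\<^bsub>sym_group n\<^esub> (m::nat)) i = rep n (int i + int m)"
  using assms(2)
proof (induction m arbitrary: i)
  case 0
  thus ?case using assms(1) by (simp add: sym_group_one rep_eqI)
next
  case (Suc m)
  have "(shift n [^]\<^bsub>sym_group n\<^esub> Suc m) i = (shift n [^]\<^bsub>sym_group n\<^esub> m) (shift n i)"
    by (simp add: sym_group_mult)
  also have "\<dots> = rep n (int (rep n (int i + 1)) + int m)"
    using Suc rep_in[OF assms(1)] shift_apply[OF assms(1)] by simp
  also have "\<dots> = rep n (int i + int (Suc m))"
    using cong_add[OF rep_cong[OF assms(1), of "int i + 1"] cong_refl[of "int m"]]
    by (intro rep_congI) (simp add: algebra_simps)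
  finally show ?case .
qed

lemma shift_pow_apply:
  assumes "n > 0" "i \<in> {1..n}"
  shows "(shift n [^]\<^bsub>sym_group n\<^esub> (r::int)) i = rep n (int i + r)"
proof (cases r rule: int_cases2)
  case (nonneg m)
  thus ?thesis using shift_nat_pow_apply[OF assms] by (simp add: int_pow_int)
next
  case (nonpos m)
  let ?p = "shift n [^]\<^bsub>sym_group n\<^esub> m"
  interpret group "sym_group n" by (rule sym_group_is_group)
  have p: "?p \<in> carrier (sym_group n)"
    by (simp add: shift_closed)
  hence perm: "?p permutes {1..n}"
    by (simp add: sym_group_carrier)
  have "[int i - int m + int m = int (rep n (int i - int m)) + int m] (mod int n)"
    by (intro cong_add cong_refl cong_sym[OF rep_cong[OF assms(1)]])
  hence "?p (rep n (int i - int m)) = i"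
    using assms rep_in[OF assms(1)]
    by (subst shift_nat_pow_apply) (auto intro!: rep_eqI)
  hence "inv' ?p i = rep n (int i - int m)"
    using permutes_inverses(2)[OF perm] by metis
  thus ?thesis
    using nonpos p by (simp add: int_pow_neg_int shift_closed)
qed

lemma ract_shift_pow:
  assumes "n > 0"
  shows "ract n x (shift n [^]\<^bsub>sym_group n\<^esub> (r::int)) =
    shift n [^]\<^bsub>sym_group n\<^esub> (- int (x (rep n r)))
      \<otimes>\<^bsub>sym_group n\<^esub> x \<otimes>\<^bsub>sym_group n\<^esub> shift n [^]\<^bsub>sym_group n\<^esub> r"
proof -
  have *: "(shift n [^]\<^bsub>sym_group n\<^esub> s) n = rep n s" for s :: int
  proof -
    have "(shift n [^]\<^bsub>sym_group n\<^esub> s) n = rep n (int n + s)"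
      using assms by (intro shift_pow_apply) auto
    also have "\<dots> = rep n s"
      by (intro rep_congI) (simp add: cong_def)
    finally show ?thesis .
  qed
  show ?thesis
    unfolding ract_def
  proof (rule the_equality, rule exI[of _ r], rule conjI[OF refl refl], elim exE conjE)
    fix y and s :: int
    assume eq: "shift n [^]\<^bsub>sym_group n\<^esub> r = shift n [^]\<^bsub>sym_group n\<^esub> s"
      and y: "y = shift n [^]\<^bsub>sym_group n\<^esub> (- int (x (rep n s)))
        \<otimes>\<^bsub>sym_group n\<^esub> x \<otimes>\<^bsub>sym_group n\<^esub> shift n [^]\<^bsub>sym_group n\<^esub> s"
    have "rep n s = rep n r"
      using *[of r] *[of s] unfolding eq by (rule trans[OF sym, rotated])
    thus "y = shift n [^]\<^bsub>sym_group n\<^esub> (- int (x (rep n r)))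
        \<otimes>\<^bsub>sym_group n\<^esub> x \<otimes>\<^bsub>sym_group n\<^esub> shift n [^]\<^bsub>sym_group n\<^esub> r"
      unfolding y eq by (rule arg_cong)
  qed
qed

end

theory Submission
  imports Defs
begin

text \<open>
  Lift \<open>x\<close> to a map \<open>f\<close> on the integers. That \<open>a\<^sup>t\<close> stabilizes \<open>x\<close> says that
  \<open>f (k + t) = f k + f t\<close> modulo \<open>n\<close>, hence \<open>f (k + q t) = f k + q f t\<close> for all integers \<open>q\<close>.
  Taking \<open>k = 0\<close> and \<open>q = n / t\<close> shows that \<open>t\<close> divides \<open>f t\<close>, so \<open>f t = j t\<close>, and injectivity of
  \<open>x\<close> on the multiples of \<open>t\<close> forces \<open>j\<close> to be invertible modulo \<open>n / t\<close>. Consequently \<open>f\<close> induces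
  an injective map modulo \<open>t\<close> that fixes \<open>0\<close>; this is \<open>\<sigma>\<close>, and the \<open>u i\<close> are the quotients.
\<close>

section \<open>Equivariant maps on the integers\<close>

locale translation_equivariant =
  fixes f :: "int \<Rightarrow> int" and n m t :: int
  assumes n_eq: "n = m * t" and t_pos: "t > 0" and m_pos: "m > 0"
    and cong_iff: "[f k = f l] (mod n) \<longleftrightarrow> [k = l] (mod n)"
    and zero: "[f 0 = 0] (mod n)"
    and step: "[f (k + t) = f k + f t] (mod n)"
begin

text \<open>Induction runs in both directions from 0, because multipliers used later, such as
  \<open>- u (\<tau> k) * i\<close>, can be negative.\<close>

lemma translate: "[f (k + q * t) = f k + q * f t] (mod n)"
proof (induction q rule: int_induct[where k = 0])
  case base
  show ?case by simp
next
  case (step1 q)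
  have "[f ((k + q * t) + t) = f (k + q * t) + f t] (mod n)"
    by (rule step)
  also have "[f (k + q * t) + f t = (f k + q * f t) + f t] (mod n)"
    by (intro cong_add step1.IH cong_refl)
  finally show ?case by (simp add: algebra_simps)
next
  case (step2 q)
  have "[f (k + (q - 1) * t) + f t = f ((k + (q - 1) * t) + t)] (mod n)"
    by (rule cong_sym[OF step])
  also have "f ((k + (q - 1) * t) + t) = f (k + q * t)"
    by (simp add: algebra_simps)
  also have "[f (k + q * t) = f k + q * f t] (mod n)"
    by (rule step2.IH)
  also have "f k + q * f t = (f k + (q - 1) * f t) + f t"
    by (simp add: algebra_simps)
  finally show ?case by (simp add: cong_add_rcancel)
qed

lemma multiple: "[f (q * t) = q * f t] (mod n)"
  using cong_trans[OF translate[of 0 q] cong_add[OF zero cong_refl]] by simp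

lemma dvd_f: "t dvd f t"
proof -
  have "[f (m * t) = f 0] (mod n)"
    unfolding cong_iff by (simp add: n_eq cong_def)
  hence "[m * f t = 0] (mod n)"
    using multiple[of m] zero by (meson cong_sym cong_trans)
  thus ?thesis
    using m_pos by (simp add: n_eq cong_0_iff)
qed

definition j :: int where "j = f t div t"

lemma f_t: "f t = j * t"
  using dvd_f by (simp add: j_def)

text \<open>If \<open>d\<close> divides \<open>j\<close> and \<open>m = d * m'\<close>, then
  \<open>m' * f t\<close> is a multiple of \<open>m * t\<close>, so \<open>m' * t\<close> and 0 have
  the same image; injectivity modulo \<open>n\<close> then leaves only a unit
  \<open>d\<close>.\<close>

lemma coprime_j: "coprime j m"
proof (rule coprimeI)
  fix d assume d: "d dvd j" "d dvd m"
  then obtain j' m' where jm: "j = d * j'" "m = d * m'" by (auto elim!: dvdE)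
  have "[m' * f t = 0] (mod n)"
    by (simp add: cong_0_iff n_eq f_t jm)
  hence "[f (m' * t) = f 0] (mod n)"
    using multiple[of m'] zero by (meson cong_sym cong_trans)
  hence "n dvd m' * t"
    by (simp add: cong_iff cong_0_iff)
  hence "d * m' dvd m'"
    using t_pos by (simp add: n_eq jm)
  thus "is_unit d"
    using m_pos jm by auto
qed

text \<open>A congruence modulo \<open>m\<close> becomes one modulo \<open>n\<close> after
  multiplication by \<open>t\<close>, so \<open>i * f t\<close> is congruent to \<open>t\<close>.
  This solves for preimages: it yields injectivity modulo \<open>t\<close> and every formula for the
  inverse of \<open>x\<close>.\<close>

lemma inverse_mod:
  assumes "[i * j = 1] (mod m)"
  shows "[f (k + q * i * t) = f k + q * t] (mod n)"
proof -
  have "[q * (i * j) * t = q * 1 * t] (mod n)"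
    using cong_mult[OF cong_refl assms, of q] unfolding n_eq
    by (simp add: cong_def mod_mult_mult2)
  hence "[f k + q * i * f t = f k + q * t] (mod n)"
    by (intro cong_add cong_refl) (simp add: f_t algebra_simps)
  with translate[of k "q * i"] show ?thesis
    by (rule cong_trans)
qed

text \<open>A difference \<open>q * t\<close> of values is produced exactly modulo \<open>n\<close>
  by moving \<open>k\<close> by \<open>q * i * t\<close>, a displacement that vanishes modulo
  \<open>t\<close>.\<close>

lemma cong_t_if:
  assumes "[f k = f l] (mod t)"
  shows "[k = l] (mod t)"
proof -
  obtain q where q: "f l = f k + q * t"
    using assms by (metis cong_iff_lin mult.commute)
  obtain i where "[i * j = 1] (mod m)"
    using cong_solve_coprime_int[OF coprime_j] by (metis mult.commute)
  hence "[f (k + q * i * t) = f l] (mod n)"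
    using inverse_mod q by simp
  hence "[k + q * i * t = l] (mod t)"
    unfolding cong_iff by (rule cong_dvd_modulus) (simp add: n_eq)
  thus ?thesis by (simp add: cong_def)
qed

end

section \<open>From the stabilizer to equivariance\<close>

text \<open>The fixed-point equation for the action of \<open>a^t\<close>, evaluated at the class of
  \<open>k\<close>, reads \<open>x(k) = x(k + t) - x(t)\<close>.\<close>

lemma stabilizer_shift_pow:
  assumes "n > 0" and "x \<in> carrier (sym_group n)"
    and "shift n [^]\<^bsub>sym_group n\<^esub> t \<in> Fstab n x"
  shows "[int (x (rep n (k + int t))) = int (x (rep n k)) + int (x (rep n (int t)))] (mod int n)"
proof -
  let ?a = "shift n" and ?p = "int (x (rep n (int t)))"
  have perm: "x permutes {1..n}"
    using assms(2) by (simp add: sym_group_carrier)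
  have x_in: "x i \<in> {1..n}" if "i \<in> {1..n}" for i
    using that permutes_in_image[OF perm] by blast
  have *: "rep n (int (rep n k) + int t) = rep n (k + int t)"
    by (intro rep_congI cong_add rep_cong assms cong_refl)
  have "x = ract n x (?a [^]\<^bsub>sym_group n\<^esub> int t)"
    using assms(3) by (simp add: Fstab_def stabilizer_def int_pow_int)
  also have "\<dots> = ?a [^]\<^bsub>sym_group n\<^esub> (- ?p)
      \<otimes>\<^bsub>sym_group n\<^esub> x \<otimes>\<^bsub>sym_group n\<^esub> ?a [^]\<^bsub>sym_group n\<^esub> int t"
    by (rule ract_shift_pow[OF assms(1)])
  finally have "x (rep n k) = (?a [^]\<^bsub>sym_group n\<^esub> (- ?p)
      \<otimes>\<^bsub>sym_group n\<^esub> x \<otimes>\<^bsub>sym_group n\<^esub> ?a [^]\<^bsub>sym_group n\<^esub> int t) (rep n k)"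
    by (rule fun_cong)
  also have "\<dots> = rep n (int (x (rep n (k + int t))) - ?p)"
    using assms(1) x_in rep_in[OF assms(1)]
    by (simp only: sym_group_mult o_apply shift_pow_apply *) simp
  finally have "[int (x (rep n k)) = int (x (rep n (k + int t))) - ?p] (mod int n)"
    using rep_cong[OF assms(1)] by metis
  from cong_add[OF this cong_refl[of ?p]] show ?thesis
    by (simp add: cong_sym)
qed

theorem lemma5p1p3:
  fixes n t :: nat and x :: "nat \<Rightarrow> nat"
  assumes "n \<ge> 2"
    and "x \<in> carrier (sym_group n)" and "x n = n"
    and "t > 0" and "t dvd n"
    and "Fstab n x = generate (sym_group n) {shift n [^]\<^bsub>sym_group n\<^esub> t}"
  shows "\<exists>(j::int) (\<sigma> :: nat \<Rightarrow> nat) (u :: nat \<Rightarrow> int).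
    coprime j (int (n div t)) \<and>
    \<sigma> \<in> carrier (sym_group (t - 1)) \<and>
    (\<forall>i\<in>{1..t-1}. 1 \<le> u i \<and> u i \<le> int (n div t)) \<and>
    (\<forall>i\<in>{1..t-1}. [int (x i) = u i * int t + int (\<sigma> i)] (mod int n)) \<and>
    (\<forall>q\<in>{1..n div t}. [int (x (q * t)) = int q * j * int t] (mod int n)) \<and>
    (\<forall>q\<in>{1..n div t}. \<forall>i\<in>{1..t-1}.
       [int (x (rep n (int (q * t + i)))) = int q * int (x t) + int (x i)] (mod int n)) \<and>
    (let jinv = modular_inverse (int (n div t)) j;
         xinv = inv\<^bsub>sym_group n\<^esub> x;
         \<sigma>inv = inv\<^bsub>sym_group (t - 1)\<^esub> \<sigma>
     in
       (\<forall>i\<in>{1..t-1}. [int (xinv i) = - jinv * u (\<sigma>inv i) * int t + int (\<sigma>inv i)] (mod int n)) \<and>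
       [int (xinv t) = jinv * int t] (mod int n) \<and>
       (\<forall>q\<in>{1..n div t}. \<forall>i\<in>{1..t-1}.
          [int (xinv (rep n (int (q * t + i)))) = int q * int (xinv t) + int (xinv i)] (mod int n)))"
proof -
  have n: "n > 0" using assms(1) by simp
  have t_le: "t \<le> n" using assms n by (auto dest: dvd_imp_le)
  have perm: "x permutes {1..n}"
    using assms(2) by (simp add: sym_group_carrier)
  have x_in: "x i \<in> {1..n}" if "i \<in> {1..n}" for i
    using that permutes_in_image[OF perm] by blast
  define m where "m = n div t"
  have nm: "n = m * t" using assms(5) by (simp add: m_def)
  have m: "m > 0" using nm n by (cases m) auto
  have rep_id: "rep n (int i) = i" if "i \<in> {1..n}" for i
    using that n by (intro rep_eqI) auto
  define f where "f k = int (x (rep n k))" for k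
  have f_x: "f (int i) = int (x i)" if "i \<in> {1..n}" for i
    using that by (simp add: f_def rep_id)
  interpret f: translation_equivariant f "int n" "int m" "int t"
  proof
    show "int n = int m * int t" using nm by simp
    show "[f k = f l] (mod int n) \<longleftrightarrow> [k = l] (mod int n)" for k l
    proof
      assume "[f k = f l] (mod int n)"
      hence "x (rep n k) = x (rep n l)"
        unfolding f_def using rep_eqI[OF n] x_in[OF rep_in[OF n]] rep_id by metis
      hence "rep n k = rep n l"
        using permutes_inj[OF perm] by (simp add: inj_eq)
      thus "[k = l] (mod int n)"
        using rep_cong[OF n] by (metis cong_sym cong_trans)
    qed (simp add: f_def rep_congI[of k l n])
    \<comment> \<open>The class of 0 is represented by \<open>n\<close>, so \<open>x n = n\<close>
      is the normalization of \<open>f\<close> at 0.\<close>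
    have "rep n 0 = n"
      using n by (intro rep_eqI) (auto simp: cong_def)
    thus "[f 0 = 0] (mod int n)"
      by (simp add: f_def assms(3) cong_def)
    have "shift n [^]\<^bsub>sym_group n\<^esub> t \<in> Fstab n x"
      unfolding assms(6) by (intro generate.incl) simp
    thus "[f (k + int t) = f k + f (int t)] (mod int n)" for k
      unfolding f_def by (intro stabilizer_shift_pow n assms(2))
  qed (use m assms in auto)

  \<comment> \<open>The permutation \<open>\<sigma>\<close> and the quotients
    \<open>u\<close>\<close>
  define \<sigma> where "\<sigma> i = (if i \<in> {1..t-1} then x i mod t else i)" for i
  \<comment> \<open>The quotient \<open>x i div t\<close> can be 0; \<open>rep m\<close> then turns
    it into \<open>m\<close>. Only its class modulo \<open>m\<close> matters, as it gets multiplied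
    by \<open>t\<close> modulo \<open>m * t\<close>.\<close>
  define u where "u i = int (rep m (int (x i div t)))" for i
  define i where "i = modular_inverse (int m) f.j"
  have i: "[i * f.j = 1] (mod int m)"
    using cong_modular_inverse2[OF f.coprime_j] by (simp add: i_def)

  have \<sigma>_cong: "[f (int k) = int (\<sigma> k)] (mod int t)" if "k \<in> {1..t-1}" for k
    using that t_le by (subst f_x) (auto simp: \<sigma>_def zmod_int cong_def)
  have \<sigma>_perm: "\<sigma> permutes {1..t-1}"
  proof (rule bij_imp_permutes)
    have "inj_on \<sigma> {1..t-1}"
    proof (rule inj_onI)
      fix k l assume kl: "k \<in> {1..t-1}" "l \<in> {1..t-1}" "\<sigma> k = \<sigma> l"
      hence "[f (int k) = f (int l)] (mod int t)"
        using \<sigma>_cong by (metis cong_sym cong_trans)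
      from f.cong_t_if[OF this] kl show "k = l"
        by (auto simp: cong_int_iff cong_def)
    qed
    moreover have "\<sigma> ` {1..t-1} \<subseteq> {1..t-1}"
    proof (intro image_subsetI)
      fix k assume k: "k \<in> {1..t-1}"
      \<comment> \<open>Since \<open>f\<close> fixes 0 modulo \<open>t\<close> and is injective
        there, a zero residue would force \<open>t\<close> to divide \<open>k\<close>.\<close>
      have "\<sigma> k \<noteq> 0"
      proof
        assume "\<sigma> k = 0"
        moreover have "[f 0 = 0] (mod int t)"
          using f.zero by (rule cong_dvd_modulus) (simp add: assms(5))
        ultimately have "[f (int k) = f 0] (mod int t)"
          using \<sigma>_cong[OF k] by (metis cong_sym cong_trans of_nat_0)
        from f.cong_t_if[OF this] k show False
          by (auto simp: cong_0_iff dest: dvd_imp_le)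
      qed
      moreover have "\<sigma> k < t"
        using k assms(4) by (simp add: \<sigma>_def)
      ultimately show "\<sigma> k \<in> {1..t-1}" by auto
    qed
    ultimately show "bij_betw \<sigma> {1..t-1} {1..t-1}"
      by (simp add: bij_betw_def endo_inj_surj)
  qed (auto simp: \<sigma>_def)
  have \<sigma>_carrier: "\<sigma> \<in> carrier (sym_group (t - 1))"
    using \<sigma>_perm by (simp add: sym_group_carrier)

  have u_cong: "[int (x k) = u k * int t + int (\<sigma> k)] (mod int n)" if "k \<in> {1..t-1}" for k
  proof -
    have "[int (x k div t) * int t = u k * int t] (mod int n)"
      using cong_sym[OF rep_cong[OF m, of "int (x k div t)"]]
      by (simp add: nm u_def cong_def mod_mult_mult2)
    from cong_add[OF this cong_refl[of "int (\<sigma> k)"]] show ?thesis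
      using that by (simp add: \<sigma>_def flip: of_nat_mult of_nat_add)
  qed

  \<comment> \<open>Formulas for the inverse\<close>
  define y where "y = inv\<^bsub>sym_group n\<^esub> x"
  define \<tau> where "\<tau> = inv\<^bsub>sym_group (t - 1)\<^esub> \<sigma>"
  have y: "y = inv' x" and \<tau>: "\<tau> = inv' \<sigma>"
    using assms(2) \<sigma>_carrier by (simp_all add: y_def \<tau>_def)
  have f_y: "f (int (y p)) = int p" if "p \<in> {1..n}" for p
  proof -
    have "y p \<in> {1..n}"
      using that permutes_in_image[OF permutes_inv[OF perm]] y by simp
    thus ?thesis
      using permutes_inverses(1)[OF perm] by (simp add: f_x y)
  qed
  \<comment> \<open>Each formula for the inverse is checked by applying \<open>f\<close> to the
    proposed value.\<close>
  have y_eqI: "[int (y p) = k] (mod int n)" if "p \<in> {1..n}" "[f k = int p] (mod int n)" for p k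
    using that f.cong_iff f_y by (metis cong_sym)
  have \<tau>_in: "\<tau> k \<in> {1..t-1}" if "k \<in> {1..t-1}" for k
    using that permutes_in_image[OF permutes_inv[OF \<sigma>_perm]] \<tau> by simp
  have in_n: "k \<in> {1..n}" if "k \<in> {1..t-1}" for k
    using that t_le by auto
  have t_in: "t \<in> {1..n}" using t_le assms(4) by simp

  have y_small: "[int (y k) = - i * u (\<tau> k) * int t + int (\<tau> k)] (mod int n)"
    if k: "k \<in> {1..t-1}" for k
  proof (rule y_eqI[OF in_n[OF k]])
    \<comment> \<open>At \<open>\<tau> k\<close> the value is \<open>u (\<tau> k) * t + k\<close>;
      the displacement is chosen to cancel the first summand.\<close>
    have "[f (int (\<tau> k) + - u (\<tau> k) * i * int t) = f (int (\<tau> k)) + - u (\<tau> k) * int t] (mod int n)"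
      by (rule f.inverse_mod[OF i])
    also have "[f (int (\<tau> k)) + - u (\<tau> k) * int t
        = (u (\<tau> k) * int t + int (\<sigma> (\<tau> k))) + - u (\<tau> k) * int t] (mod int n)"
      using u_cong[OF \<tau>_in[OF k]] f_x[OF in_n[OF \<tau>_in[OF k]]] by (intro cong_add cong_refl) simp
    also have "\<sigma> (\<tau> k) = k"
      using permutes_inverses(1)[OF \<sigma>_perm] \<tau> by simp
    finally show "[f (- i * u (\<tau> k) * int t + int (\<tau> k)) = int k] (mod int n)"
      by (simp add: algebra_simps)
  qed
  have y_t: "[int (y t) = i * int t] (mod int n)"
  proof (rule y_eqI[OF t_in])
    show "[f (i * int t) = int t] (mod int n)"
      using cong_trans[OF f.inverse_mod[OF i, of 0 1] cong_add[OF f.zero cong_refl]] by simp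
  qed
  have y_translate: "[int (y (rep n (int (q * t + k)))) = int q * int (y t) + int (y k)] (mod int n)"
    if k: "k \<in> {1..t-1}" for q k
  proof (rule y_eqI[OF rep_in[OF n]])
    \<comment> \<open>Replacing \<open>y t\<close> by \<open>i * t\<close> makes the argument a
      displacement of \<open>y k\<close> to which \<open>inverse_mod\<close> applies.\<close>
    have "[int q * int (y t) + int (y k) = int q * (i * int t) + int (y k)] (mod int n)"
      by (intro cong_add cong_mult cong_refl y_t)
    hence "[f (int q * int (y t) + int (y k)) = f (int (y k) + int q * i * int t)] (mod int n)"
      unfolding f.cong_iff by (simp add: algebra_simps)
    also have "[f (int (y k) + int q * i * int t) = f (int (y k)) + int q * int t] (mod int n)"
      by (rule f.inverse_mod[OF i])
    also have "f (int (y k)) + int q * int t = int (q * t + k)"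
      using f_y[OF in_n[OF k]] by simp
    also have "[int (q * t + k) = int (rep n (int (q * t + k)))] (mod int n)"
      by (rule cong_sym[OF rep_cong[OF n]])
    finally show "[f (int q * int (y t) + int (y k)) = int (rep n (int (q * t + k)))] (mod int n)" .
  qed

  \<comment> \<open>Formulas for \<open>x\<close>\<close>
  have x_multiple: "[int (x (q * t)) = int q * f.j * int t] (mod int n)" if "q \<in> {1..m}" for q
  proof -
    have "q * t \<in> {1..n}" using that nm assms(4) by auto
    from f_x[OF this] f.multiple[of "int q"] show ?thesis
      by (simp add: f.f_t mult.assoc)
  qed
  \<comment> \<open>For \<open>q = m\<close> the number \<open>q * t + k\<close> exceeds
    \<open>n\<close>; the reduction by \<open>rep\<close> is the one built into
    \<open>f\<close>.\<close>
  have x_translate: "[int (x (rep n (int (q * t + k)))) = int q * int (x t) + int (x k)] (mod int n)"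
    if "k \<in> {1..t-1}" for q k
    using f.translate[of "int k" "int q"] f_x[OF in_n[OF that]] f_x[OF t_in]
    by (simp add: f_def add.commute)
  have u_bounds: "1 \<le> u k \<and> u k \<le> int m" for k
    using rep_in[OF m] by (auto simp: u_def)
  show ?thesis
    unfolding Let_def m_def[symmetric]
    by (rule exI[of _ f.j], rule exI[of _ \<sigma>], rule exI[of _ u],
        fold i_def y_def \<tau>_def,
        intro conjI ballI f.coprime_j \<sigma>_carrier u_bounds[THEN conjunct1] u_bounds[THEN conjunct2]
          u_cong x_multiple x_translate y_small y_t y_translate)
qed

end
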